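(* The effective operators $\bar H$ and $\bar b$ satisfy $$\lim_{|P|\to +\infty}\frac{\bar H(P, \alpha)}{|P|^2} =\frac{1}{2} \qquad\text{and}\qquad \lim_{|P|\to +\infty}\frac{|\bar b(P, \alpha)-P|}{|P|}=0,$$ uniformly for $\alpha \in [0,+\infty)$.
   Context: $\mathbb{T}^n=\mathbb{R}^n/\mathbb{Z}^n$ is the unit torus. Standing assumptions on $V:\mathbb{T}^n\times\mathbb{R}\to\mathbb{R}$: $V$ is a bounded $C^1$ function, $V\ge 0$, and for every compact interval $K\subset\mathbb{R}$ there is $\gamma_K>0$ with $V(y,m)-V(y,m')\ge\gamma_K(m-m')$ for all $m\ge m'$ in $K$ and all $y\in\mathbb{T}^n$. Cell problem and effective operators: for $P\in\mathbb{R}^n$ and $\alpha\ge0$, $\bar H(P,\alpha)$ is the unique constant for which the cell problem $$-\Delta u+\tfrac12|\nabla u+P|^2-V(y,\alpha m)=\bar H(P,\alpha),\quad -\Delta m-\mathrm{div}(m(\nabla u+P))=0\ \text{ on }\mathbb{T}^n,\quad \int_{\mathbb{T}^n}u=0,\ \int_{\mathbb{T}^n}m=1$$ admits a solution $(u,m)$; this solution is unique, with $u\in C^{2,\gamma}(\mathbb{T}^n)$ for all $\gamma\in(0,1)$, $m\in W^{1,p}(\mathbb{T}^n)$ for all $p>1$, $m>0$. One sets $\bar b(P,\alpha)=\int_{\mathbb{T}^n}(\nabla u+P)\,m\,dy\in\mathbb{R}^n$. *)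

theory Defs
  imports "HOL-Analysis.Analysis"
begin

text \<open>
  Functions on the unit torus are represented by functions on \<^typ>\<open>real^'n\<close> that are
  invariant under integer translations; integrals over the torus are Lebesgue integrals over
  the unit cube.
\<close>

definition periodic :: "(real^'n \<Rightarrow> 'b) \<Rightarrow> bool" where
  "periodic f \<longleftrightarrow> (\<forall>x k. (\<forall>i. k $ i \<in> \<int>) \<longrightarrow> f (x + k) = f x)"

abbreviation unit_cube :: "(real^'n) set" where
  "unit_cube \<equiv> cbox 0 1"

definition dir_deriv :: "'a::euclidean_space \<Rightarrow> ('a \<Rightarrow> real) \<Rightarrow> 'a \<Rightarrow> real" where
  "dir_deriv b f x = frechet_derivative f (at x) b"

primrec Ck :: "nat \<Rightarrow> ('a::euclidean_space \<Rightarrow> real) \<Rightarrow> bool" where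
  "Ck 0 f \<longleftrightarrow> continuous_on UNIV f"
| "Ck (Suc k) f \<longleftrightarrow> (\<forall>x. f differentiable (at x)) \<and> (\<forall>b\<in>Basis. Ck k (dir_deriv b f))"

definition smooth :: "('a::euclidean_space \<Rightarrow> real) \<Rightarrow> bool" where
  "smooth f \<longleftrightarrow> (\<forall>k. Ck k f)"

definition grad :: "('a::euclidean_space \<Rightarrow> real) \<Rightarrow> 'a \<Rightarrow> 'a" where
  "grad f x = (\<Sum>b\<in>Basis. dir_deriv b f x *\<^sub>R b)"

definition laplacian :: "('a::euclidean_space \<Rightarrow> real) \<Rightarrow> 'a \<Rightarrow> real" where
  "laplacian f x = (\<Sum>b\<in>Basis. dir_deriv b (dir_deriv b f) x)"

text \<open>
  The space \<open>C\<^sup>2\<^sup>,\<^sup>\<gamma>\<close> of the torus. For a periodic function, being Hoelder for the Euclidean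
  distance of the covering space is the same as being Hoelder for the distance of the torus.
\<close>

definition C2_holder :: "real \<Rightarrow> (real^'n \<Rightarrow> real) \<Rightarrow> bool" where
  "C2_holder \<gamma> u \<longleftrightarrow> periodic u \<and> Ck 2 u \<and>
     (\<forall>b\<in>Basis. \<forall>c\<in>Basis. \<exists>C. \<forall>x y.
        \<bar>dir_deriv b (dir_deriv c u) x - dir_deriv b (dir_deriv c u) y\<bar> \<le> C * dist x y powr \<gamma>)"

definition Lp_torus :: "real \<Rightarrow> (real^'n \<Rightarrow> real) \<Rightarrow> bool" where
  "Lp_torus p f \<longleftrightarrow> periodic f \<and> f \<in> borel_measurable lebesgue \<and>
     set_integrable lebesgue unit_cube (\<lambda>x. \<bar>f x\<bar> powr p)"

definition weak_gradient :: "(real^'n \<Rightarrow> real) \<Rightarrow> (real^'n \<Rightarrow> real^'n) \<Rightarrow> bool" where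
  "weak_gradient f G \<longleftrightarrow> Lp_torus 1 f \<and> (\<forall>b\<in>Basis. Lp_torus 1 (\<lambda>x. G x \<bullet> b)) \<and>
     (\<forall>\<phi>. smooth \<phi> \<and> periodic \<phi> \<longrightarrow> (\<forall>b\<in>Basis.
        (LINT x:unit_cube|lebesgue. f x * dir_deriv b \<phi> x) =
        - (LINT x:unit_cube|lebesgue. (G x \<bullet> b) * \<phi> x)))"

definition W1p_torus :: "real \<Rightarrow> (real^'n \<Rightarrow> real) \<Rightarrow> bool" where
  "W1p_torus p f \<longleftrightarrow> Lp_torus p f \<and>
     (\<exists>G. weak_gradient f G \<and> (\<forall>b\<in>Basis. Lp_torus p (\<lambda>x. G x \<bullet> b)))"

definition admissible_potential :: "(real^'n \<Rightarrow> real \<Rightarrow> real) \<Rightarrow> bool" where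
  "admissible_potential V \<longleftrightarrow>
     (\<forall>m. periodic (\<lambda>y. V y m)) \<and>
     Ck 1 (\<lambda>z::(real^'n) \<times> real. V (fst z) (snd z)) \<and>
     (\<exists>C. \<forall>y m. \<bar>V y m\<bar> \<le> C) \<and>
     (\<forall>y m. 0 \<le> V y m) \<and>
     (\<forall>a b. \<exists>\<gamma>>0. \<forall>m\<in>{a..b}. \<forall>m'\<in>{a..b}. \<forall>y.
        m' \<le> m \<longrightarrow> \<gamma> * (m - m') \<le> V y m - V y m')"

text \<open>
  Weak formulation of \<open>- \<Delta>m - div (m (\<nabla>u + P)) = 0\<close> on the torus. The weak gradient is
  unique up to null sets, so it does not matter which one is used.
\<close>

definition weak_fokker_planck ::
    "real^'n \<Rightarrow> (real^'n \<Rightarrow> real) \<Rightarrow> (real^'n \<Rightarrow> real) \<Rightarrow> bool" where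
  "weak_fokker_planck P u m \<longleftrightarrow> (\<exists>G. weak_gradient m G \<and>
     (\<forall>\<phi>. smooth \<phi> \<and> periodic \<phi> \<longrightarrow>
        (LINT x:unit_cube|lebesgue. (G x + m x *\<^sub>R (grad u x + P)) \<bullet> grad \<phi> x) = 0))"

text \<open>
  An element of \<open>W\<^sup>1\<^sup>,\<^sup>p\<close> for all \<open>p > 1\<close> has a continuous representative; \<open>m\<close> denotes that
  representative, so that the first equation and \<open>m > 0\<close> are meaningful pointwise.
\<close>

definition cell_solution ::
    "(real^'n \<Rightarrow> real \<Rightarrow> real) \<Rightarrow> real^'n \<Rightarrow> real \<Rightarrow> real \<Rightarrow>
     (real^'n \<Rightarrow> real) \<Rightarrow> (real^'n \<Rightarrow> real) \<Rightarrow> bool" where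
  "cell_solution V P \<alpha> h u m \<longleftrightarrow>
     (\<forall>\<gamma>. 0 < \<gamma> \<and> \<gamma> < 1 \<longrightarrow> C2_holder \<gamma> u) \<and>
     continuous_on UNIV m \<and> (\<forall>p>1. W1p_torus p m) \<and> (\<forall>y. 0 < m y) \<and>
     (\<forall>y. - laplacian u y + (1/2) * (norm (grad u y + P))\<^sup>2 - V y (\<alpha> * m y) = h) \<and>
     weak_fokker_planck P u m \<and>
     (LINT y:unit_cube|lebesgue. u y) = 0 \<and>
     (LINT y:unit_cube|lebesgue. m y) = 1"

text \<open>
  \<open>Hb P \<alpha>\<close> is the constant for which the cell problem is solvable, and \<open>bb P \<alpha>\<close> is the mean
  drift of the solution. Since that constant and the solution are unique, this determines both
  functions on \<open>\<alpha> \<ge> 0\<close>; uniqueness itself need not be part of the condition.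
\<close>

definition effective_operators ::
    "(real^'n \<Rightarrow> real \<Rightarrow> real) \<Rightarrow> (real^'n \<Rightarrow> real \<Rightarrow> real) \<Rightarrow>
     (real^'n \<Rightarrow> real \<Rightarrow> real^'n) \<Rightarrow> bool" where
  "effective_operators V Hb bb \<longleftrightarrow> (\<forall>P. \<forall>\<alpha>\<ge>0. \<exists>u m.
     cell_solution V P \<alpha> (Hb P \<alpha>) u m \<and>
     bb P \<alpha> = (LINT y:unit_cube|lebesgue. m y *\<^sub>R (grad u y + P)))"

end

theory Submission imports Defs begin

text \<open>
  Let \<open>C\<close> be a bound for \<open>V\<close>. Both limits hold with explicit rates that depend only on \<open>C\<close>: for a
  solution \<open>(u, m)\<close> of the cell problem with constant \<open>h\<close>,
    \<^item> \<open>|P|\<^sup>2/2 - C \<le> h \<le> |P|\<^sup>2/2\<close>, and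
    \<^item> the mean drift differs from \<open>P\<close> by at most \<open>1/2 + C\<close>.

  The first estimate is the maximum principle. Where \<open>u\<close> is extremal, \<open>\<nabla>u = 0\<close> and \<open>\<Delta>u\<close> has a sign,
  so that the Hamilton-Jacobi equation compares \<open>h\<close> with \<open>|P|\<^sup>2/2 - V\<close>, and \<open>0 \<le> V \<le> C\<close>.

  The second estimate is an energy identity. The mean drift minus \<open>P\<close> is the integral of
  \<open>m \<nabla>u\<close>. Multiplying the Hamilton-Jacobi equation by \<open>m\<close>, integrating, and subtracting the
  Fokker-Planck equation tested with \<open>u\<close> gives that the integral of \<open>m |\<nabla>u|\<^sup>2/2\<close> is \<open>|P|\<^sup>2/2 - h\<close> minus
  the integral of \<open>m V\<close>. By the first estimate it is at most \<open>C\<close>, and \<open>m\<close> is a probability density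
  (lemma \<open>cell_solution_estimates\<close>).

  The technical point is that \<open>u\<close> is only of class \<open>C\<^sup>2\<close>, whereas the Fokker-Planck equation is
  given for smooth periodic test functions. Hence \<open>u\<close> is convolved with a kernel that is a
  trigonometric polynomial, a normalised power of \<open>\<Prod>\<^sub>i (1 + cos (2 \<pi> y\<^sub>i))/2\<close>. The result is
  a trigonometric polynomial, thus an admissible test function (lemma \<open>trig_poly_mollify\<close>). It
  converges to \<open>u\<close> uniformly with all derivatives up to the second order, because convolution
  commutes with differentiation and the kernels concentrate at the lattice points (lemmas
  \<open>dir_deriv_mollify\<close> and \<open>mollify_uniform_limit\<close>). Moreover, the weak gradient of \<open>m\<close> can be eliminated
  before passing to the limit (lemma \<open>dual_equation_trig_poly\<close>), after which the identity contains
  only \<open>m\<close>, \<open>\<nabla>u\<close> and derivatives of the test function. The limit is lemma \<open>dual_equation\<close>.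
\<close>

section \<open>Integrals of periodic functions\<close>

lemma periodicD: "periodic f \<Longrightarrow> (\<And>i. k $ i \<in> \<int>) \<Longrightarrow> f (x + k) = f x"
  by (simp add: periodic_def)

text \<open>
  A shift by \<open>s \<in> [0, 1]\<close> along one axis pushes a slab of thickness \<open>s\<close> out of the cube at one face;
  by periodicity it can be put back at the opposite face.
\<close>

lemma integral_cube_shift_axis_frac:
  fixes f :: "real^'n \<Rightarrow> real" and i :: 'n
  assumes per: "periodic f" and cont: "continuous_on UNIV f" and s: "0 \<le> s" "s \<le> 1"
  shows "integral unit_cube (\<lambda>x. f (x + axis i s)) = integral unit_cube f"
proof -
  let ?e = "axis i (1::real) :: real^'n" and ?s = "axis i s :: real^'n"
  have c: "continuous_on S f" for S using cont continuous_on_subset by blast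
  have hI: "(f has_integral integral (cbox a b) f) (cbox a b)" for a b
    by (intro integrable_integral integrable_continuous c)
  have e: "?e \<in> Basis" by (simp add: axis_in_Basis_iff)
  have in_box: "x \<in> cbox a b \<longleftrightarrow> (a $ i \<le> x $ i \<and> x $ i \<le> b $ i) \<and>
      (\<forall>j. j \<noteq> i \<longrightarrow> a $ j \<le> x $ j \<and> x $ j \<le> b $ j)" for x a b :: "real^'n"
    by (metis mem_box_cart(2))
  have axis: "axis i a $ i = a" "j \<noteq> i \<Longrightarrow> axis i a $ j = 0" for a :: real and j
    by (simp_all add: axis_def)
  have inner: "x \<bullet> ?e = x $ i" for x :: "real^'n"
    by (simp add: inner_axis)
  have "integral unit_cube (\<lambda>x. f (x + ?s)) = integral (cbox ?s (1 + ?s)) f"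
    using integral_shift_cbox[of ?s ?s "1 + ?s" f] by simp
  \<comment> \<open>Cut the shifted cube at coordinate \<open>1\<close>; the part beyond the cut is the slab to be moved.\<close>
  also have "\<dots> = integral (cbox ?s 1) f + integral (cbox ?e (1 + ?s)) f"
  proof -
    have A: "cbox ?s (1 + ?s) \<inter> {x. x \<bullet> ?e \<le> 1} = cbox ?s 1"
      using s by (auto simp: in_box axis inner)
    have B: "cbox ?s (1 + ?s) \<inter> {x. x \<bullet> ?e \<ge> 1} = cbox ?e (1 + ?s)"
      using s by (auto simp: in_box axis inner)
    show ?thesis
      by (rule integral_unique, rule has_integral_split[OF _ _ e, of _ _ _ _ 1])
         (simp_all only: A B hI)
  qed
  also have "integral (cbox ?e (1 + ?s)) f = integral (cbox 0 (1 + ?s - ?e)) (\<lambda>x. f (x + ?e))"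
    using integral_shift_cbox[of ?e ?e "1 + ?s" f] by simp
  also have "(\<lambda>x. f (x + ?e)) = f"
    using per by (intro ext periodicD) (auto simp: axis_def)
  also have "integral (cbox ?s 1) f + integral (cbox 0 (1 + ?s - ?e)) f = integral unit_cube f"
  proof -
    have A: "unit_cube \<inter> {x. x \<bullet> ?e \<le> s} = cbox 0 (1 + ?s - ?e)"
      using s by (auto simp: in_box axis inner)
    have B: "unit_cube \<inter> {x. x \<bullet> ?e \<ge> s} = cbox ?s 1"
      using s by (auto simp: in_box axis inner)
    have "integral unit_cube f = integral (cbox 0 (1 + ?s - ?e)) f + integral (cbox ?s 1) f"
      by (rule integral_unique, rule has_integral_split[OF _ _ e, of _ _ _ _ s])
         (simp_all only: A B hI)
    then show ?thesis by simp
  qed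
  finally show ?thesis .
qed

lemma periodic_shift: "periodic f \<Longrightarrow> periodic (\<lambda>x. f (x + a))"
  unfolding periodic_def by (metis add.assoc add.commute)

lemma integral_cube_shift_axis:
  fixes f :: "real^'n \<Rightarrow> real" and i :: 'n
  assumes per: "periodic f" and cont: "continuous_on UNIV f"
  shows "integral unit_cube (\<lambda>x. f (x + axis i s)) = integral unit_cube f"
proof -
  have "f (x + axis i s) = f (x + axis i (frac s))" for x
  proof -
    have "x + axis i s = (x + axis i (frac s)) + axis i (of_int \<lfloor>s\<rfloor>)"
      by (auto simp: vec_eq_iff axis_def frac_def)
    moreover have "f ((x + axis i (frac s)) + axis i (of_int \<lfloor>s\<rfloor>)) = f (x + axis i (frac s))"
      by (rule periodicD[OF per]) (simp add: axis_def)
    ultimately show ?thesis by (simp only:)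
  qed
  then show ?thesis
    using integral_cube_shift_axis_frac[OF per cont, of "frac s" i] frac_lt_1[of s] by simp
qed

lemma integral_cube_shift:
  fixes f :: "real^'n \<Rightarrow> real"
  assumes per: "periodic f" and cont: "continuous_on UNIV f"
  shows "integral unit_cube (\<lambda>x. f (x + a)) = integral unit_cube f"
proof -
  have "finite S \<Longrightarrow> integral unit_cube (\<lambda>x. f (x + (\<Sum>i\<in>S. axis i (a $ i)))) = integral unit_cube f" for S
  proof (induction S rule: finite_induct)
    case (insert i S)
    let ?g = "\<lambda>x. f (x + (\<Sum>i\<in>S. axis i (a $ i)))"
    have "integral unit_cube (\<lambda>x. ?g (x + axis i (a $ i))) = integral unit_cube ?g"
      by (intro integral_cube_shift_axis periodic_shift per continuous_intros
            continuous_on_compose2[OF cont]) auto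
    with insert show ?case by (simp add: add.assoc)
  qed simp
  moreover have "(\<Sum>i\<in>UNIV. axis i (a $ i)) = a"
    by (simp add: vec_eq_iff axis_def)
  ultimately show ?thesis by (metis finite)
qed

text \<open>
  This makes the convolution over the torus symmetric in its two arguments. The reflected cube is
  \<open>[-1, 0]\<^sup>n\<close>, which an integer shift brings back to the unit cube.
\<close>

lemma integral_cube_reflect:
  fixes f :: "real^'n \<Rightarrow> real"
  assumes per: "periodic f" and cont: "continuous_on UNIV f"
  shows "integral unit_cube (\<lambda>y. f (x - y)) = integral unit_cube f"
proof -
  have "integral unit_cube (\<lambda>y. f (x - y)) = integral (cbox (-1) 0) (\<lambda>y. f (x + y))"
    using integral_reflect[of 1 0 "\<lambda>y. f (x - y)"] by simp
  also have "\<dots> = integral unit_cube (\<lambda>y. f (x + (y - 1)))"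
    using integral_shift_cbox[of 0 1 1 "\<lambda>y. f (x + (y - 1))"] by simp
  also have "\<dots> = integral unit_cube (\<lambda>y. f (y + (x - 1)))"
    by (simp add: algebra_simps)
  also have "\<dots> = integral unit_cube f" by (rule integral_cube_shift[OF per cont])
  finally show ?thesis .
qed

section \<open>Trigonometric polynomials and convolution\<close>

text \<open>
  The smooth periodic functions used as test functions. The class is closed under differentiation,
  so that smoothness of its members needs no separate argument for each order.
\<close>

inductive trig_poly :: "(real^'n \<Rightarrow> real) \<Rightarrow> bool" where
  const: "trig_poly (\<lambda>x. c)"
| cos: "trig_poly (\<lambda>x. cos (2 * pi * x $ i))"
| sin: "trig_poly (\<lambda>x. sin (2 * pi * x $ i))"
| add: "trig_poly p \<Longrightarrow> trig_poly q \<Longrightarrow> trig_poly (\<lambda>x. p x + q x)"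
| mult: "trig_poly p \<Longrightarrow> trig_poly q \<Longrightarrow> trig_poly (\<lambda>x. p x * q x)"

lemma trig_poly_diff: "trig_poly p \<Longrightarrow> trig_poly q \<Longrightarrow> trig_poly (\<lambda>x. p x - q x)"
  using trig_poly.add[OF _ trig_poly.mult[OF trig_poly.const[of "-1"]], of p q] by simp

lemma trig_poly_power: "trig_poly p \<Longrightarrow> trig_poly (\<lambda>x. p x ^ k)"
  by (induction k) (auto intro: trig_poly.intros)

lemma trig_poly_prod: "finite S \<Longrightarrow> (\<And>i. i \<in> S \<Longrightarrow> trig_poly (p i)) \<Longrightarrow> trig_poly (\<lambda>x. \<Prod>i\<in>S. p i x)"
  by (induction S rule: finite_induct) (auto intro: trig_poly.intros)

lemma trig_poly_has_derivative:
  fixes p :: "real^'n \<Rightarrow> real"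
  assumes "trig_poly p"
  shows "\<exists>p'. (\<forall>v. trig_poly (p' v)) \<and> (\<forall>x. (p has_derivative (\<lambda>v. p' v x)) (at x))"
  using assms
proof induction
  case (const c)
  show ?case by (rule exI[of _ "\<lambda>v x. 0"]) (auto intro: trig_poly.intros)
next
  case (cos i)
  have "trig_poly (\<lambda>x. (- 2 * pi * v $ i) * sin (2 * pi * x $ i))" for v :: "real^'n"
    by (intro trig_poly.intros)
  then show ?case
    by (intro exI[of _ "\<lambda>v x. (- 2 * pi * v $ i) * sin (2 * pi * x $ i)"] conjI allI)
       (auto intro!: derivative_eq_intros bounded_linear_imp_has_derivative bounded_linear_vec_nth simp: algebra_simps)
next
  case (sin i)
  have "trig_poly (\<lambda>x. (2 * pi * v $ i) * cos (2 * pi * x $ i))" for v :: "real^'n"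
    by (intro trig_poly.intros)
  then show ?case
    by (intro exI[of _ "\<lambda>v x. (2 * pi * v $ i) * cos (2 * pi * x $ i)"] conjI allI)
       (auto intro!: derivative_eq_intros bounded_linear_imp_has_derivative bounded_linear_vec_nth simp: algebra_simps)
next
  case (add p q)
  then obtain p' q' where "\<And>v. trig_poly (p' v)" "\<And>x. (p has_derivative (\<lambda>v. p' v x)) (at x)"
    "\<And>v. trig_poly (q' v)" "\<And>x. (q has_derivative (\<lambda>v. q' v x)) (at x)" by metis
  then show ?case
    by (intro exI[of _ "\<lambda>v x. p' v x + q' v x"])
       (auto intro: trig_poly.intros has_derivative_add)
next
  case (mult p q)
  then obtain p' q' where "\<And>v. trig_poly (p' v)" "\<And>x. (p has_derivative (\<lambda>v. p' v x)) (at x)"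
    "\<And>v. trig_poly (q' v)" "\<And>x. (q has_derivative (\<lambda>v. q' v x)) (at x)" by metis
  with mult show ?case
    by (intro exI[of _ "\<lambda>v x. p x * q' v x + p' v x * q x"])
       (auto intro!: trig_poly.add trig_poly.mult has_derivative_mult)
qed

lemma trig_poly_dir_deriv:
  assumes "trig_poly p"
  shows "p differentiable (at x)" "trig_poly (dir_deriv b p)"
proof -
  obtain p' where p': "\<And>v. trig_poly (p' v)" "\<And>x. (p has_derivative (\<lambda>v. p' v x)) (at x)"
    using trig_poly_has_derivative[OF assms] by metis
  show "p differentiable (at x)" using p'(2) differentiable_def by blast
  have "dir_deriv b p = p' b"
    using frechet_derivative_at[OF p'(2)] by (metis dir_deriv_def ext)
  then show "trig_poly (dir_deriv b p)" using p' by simp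
qed

lemma trig_poly_continuous: "trig_poly p \<Longrightarrow> continuous_on UNIV p"
  by (simp add: differentiable_imp_continuous_on differentiable_on_def trig_poly_dir_deriv)

lemma trig_poly_smooth:
  assumes "trig_poly p"
  shows "smooth p"
proof -
  have "Ck k p" for k
    using assms by (induction k arbitrary: p) (auto simp: trig_poly_dir_deriv trig_poly_continuous)
  then show ?thesis by (simp add: smooth_def)
qed

lemma cos_sin_add_Ints:
  assumes "k \<in> \<int>"
  shows "cos (2 * pi * (x + k)) = cos (2 * pi * x)" "sin (2 * pi * (x + k)) = sin (2 * pi * x)"
  using assms by (auto simp: distrib_left cos_add sin_add cos_integer_2pi sin_integer_2pi)

lemma trig_poly_periodic:
  assumes "trig_poly p"
  shows "periodic p"
  using assms by induction (auto simp: periodic_def cos_sin_add_Ints)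

text \<open>
  That every convolution with \<open>p\<close> is a trigonometric polynomial does not pass from two factors to
  their product. The induction is therefore on multipliers: multiplying a kernel by a trigonometric
  polynomial preserves the property of being a kernel of this kind.
\<close>

definition convolves_to_trig_poly :: "(real^'n \<Rightarrow> real) \<Rightarrow> bool" where
  "convolves_to_trig_poly K \<longleftrightarrow> continuous_on UNIV K \<and>
     (\<forall>g. continuous_on UNIV g \<longrightarrow> trig_poly (\<lambda>x. integral unit_cube (\<lambda>y. g y * K (x - y))))"

text \<open>
  For a factor \<open>cos\<close> or \<open>sin\<close> the addition theorem separates \<open>x\<close> from \<open>y\<close>: the part in \<open>x\<close> leaves the
  integral, and the part in \<open>y\<close> is absorbed in \<open>g\<close>. This is why \<open>g\<close> is arbitrary in the property.
\<close>

lemma convolves_to_trig_poly_mult: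
  fixes p :: "real^'n \<Rightarrow> real"
  assumes "trig_poly p" "convolves_to_trig_poly K"
  shows "convolves_to_trig_poly (\<lambda>x. p x * K x)"
  using assms
proof (induction arbitrary: K)
  case (const c)
  then show ?case unfolding convolves_to_trig_poly_def
    by (auto intro!: continuous_intros trig_poly.intros simp: mult.left_commute)
next
  case (cos i)
  then have K: "continuous_on UNIV K" by (simp add: convolves_to_trig_poly_def)
  have tp: "continuous_on UNIV g \<Longrightarrow> trig_poly (\<lambda>x. integral unit_cube (\<lambda>y. g y * K (x - y)))" for g
    using cos by (simp add: convolves_to_trig_poly_def)
  have "trig_poly (\<lambda>x. integral unit_cube (\<lambda>y. g y * (cos (2 * pi * (x - y) $ i) * K (x - y))))"
    if g: "continuous_on UNIV g" for g
  proof -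
    let ?c = "\<lambda>y::real^'n. cos (2 * pi * y $ i)" and ?s = "\<lambda>y::real^'n. sin (2 * pi * y $ i)"
    have "integral unit_cube (\<lambda>y. g y * (cos (2 * pi * (x - y) $ i) * K (x - y))) =
      ?c x * integral unit_cube (\<lambda>y. (g y * ?c y) * K (x - y)) +
      ?s x * integral unit_cube (\<lambda>y. (g y * ?s y) * K (x - y))" for x
    proof -
      have "(\<lambda>y. g y * (cos (2 * pi * (x - y) $ i) * K (x - y))) =
        (\<lambda>y. ?c x * ((g y * ?c y) * K (x - y)) + ?s x * ((g y * ?s y) * K (x - y)))"
        by (auto simp: right_diff_distrib cos_diff algebra_simps)
      then show ?thesis
        by (simp only:, subst integral_add)
           (auto intro!: integrable_continuous continuous_intros continuous_on_compose2[OF K]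
              continuous_on_compose2[OF g])
    qed
    then show ?thesis
      by (auto intro!: trig_poly.intros tp g continuous_intros)
  qed
  then show ?case unfolding convolves_to_trig_poly_def
    by (auto intro!: continuous_intros K)
next
  case (sin i)
  then have K: "continuous_on UNIV K" by (simp add: convolves_to_trig_poly_def)
  have tp: "continuous_on UNIV g \<Longrightarrow> trig_poly (\<lambda>x. integral unit_cube (\<lambda>y. g y * K (x - y)))" for g
    using sin by (simp add: convolves_to_trig_poly_def)
  have "trig_poly (\<lambda>x. integral unit_cube (\<lambda>y. g y * (sin (2 * pi * (x - y) $ i) * K (x - y))))"
    if g: "continuous_on UNIV g" for g
  proof -
    let ?c = "\<lambda>y::real^'n. cos (2 * pi * y $ i)" and ?s = "\<lambda>y::real^'n. sin (2 * pi * y $ i)"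
    have "integral unit_cube (\<lambda>y. g y * (sin (2 * pi * (x - y) $ i) * K (x - y))) =
      ?s x * integral unit_cube (\<lambda>y. (g y * ?c y) * K (x - y)) -
      ?c x * integral unit_cube (\<lambda>y. (g y * ?s y) * K (x - y))" for x
    proof -
      have "(\<lambda>y. g y * (sin (2 * pi * (x - y) $ i) * K (x - y))) =
        (\<lambda>y. ?s x * ((g y * ?c y) * K (x - y)) - ?c x * ((g y * ?s y) * K (x - y)))"
        by (auto simp: right_diff_distrib sin_diff algebra_simps)
      then show ?thesis
        by (simp only:, subst Henstock_Kurzweil_Integration.integral_diff)
           (auto intro!: integrable_continuous continuous_intros continuous_on_compose2[OF K]
              continuous_on_compose2[OF g])
    qed
    then show ?thesis
      by (auto intro!: trig_poly_diff trig_poly.intros tp g continuous_intros)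
  qed
  then show ?case unfolding convolves_to_trig_poly_def
    by (auto intro!: continuous_intros K)
next
  case (add p q)
  have pK: "convolves_to_trig_poly (\<lambda>x. p x * K x)" "convolves_to_trig_poly (\<lambda>x. q x * K x)"
    using add by auto
  have cc: "continuous_on UNIV (\<lambda>x. p x * K x)" "continuous_on UNIV (\<lambda>x. q x * K x)"
    using pK by (auto simp: convolves_to_trig_poly_def)
  have "integral unit_cube (\<lambda>y. g y * ((p (x - y) + q (x - y)) * K (x - y))) =
     integral unit_cube (\<lambda>y. g y * (p (x - y) * K (x - y))) +
     integral unit_cube (\<lambda>y. g y * (q (x - y) * K (x - y)))" if g: "continuous_on UNIV g" for g x
  proof -
    have "(\<lambda>y. g y * F (x - y)) integrable_on unit_cube" if F: "continuous_on UNIV F" for F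
      by (auto intro!: integrable_continuous continuous_intros continuous_on_compose2[OF F]
          continuous_on_compose2[OF g])
    from integral_add[OF this[OF cc(1)] this[OF cc(2)]] show ?thesis
      by (simp add: algebra_simps)
  qed
  with pK show ?case
    unfolding convolves_to_trig_poly_def
    by (auto intro!: trig_poly.add continuous_intros simp: distrib_right)
next
  case (mult p q)
  then show ?case by (simp add: mult.assoc)
qed

lemma trig_poly_convolution:
  assumes "trig_poly K" "continuous_on UNIV g"
  shows "trig_poly (\<lambda>x. integral unit_cube (\<lambda>y. g y * K (x - y)))"
proof -
  have "convolves_to_trig_poly (\<lambda>x::real^'n. 1)"
    by (auto simp: convolves_to_trig_poly_def intro: trig_poly.intros)
  from convolves_to_trig_poly_mult[OF assms(1) this] show ?thesis
    using assms(2) by (simp add: convolves_to_trig_poly_def)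
qed

section \<open>Approximation by trigonometric polynomials\<close>

text \<open>
  A trigonometric polynomial with values in \<open>[0, 1]\<close> that equals \<open>1\<close> exactly on the integer lattice.
  Its normalised powers concentrate at the lattice.
\<close>

definition bump :: "real^'n \<Rightarrow> real" where
  "bump y = (\<Prod>i\<in>UNIV. (1 + cos (2 * pi * y $ i)) / 2)"

lemma trig_poly_bump: "trig_poly bump"
proof -
  have "trig_poly (\<lambda>y::real^'n. (1/2) * (1 + cos (2 * pi * y $ i)))" for i
    by (intro trig_poly.intros)
  then show ?thesis unfolding bump_def
    by (intro trig_poly_prod) (simp_all add: field_simps)
qed

lemma bump_continuous: "continuous_on S bump"
  using continuous_on_subset[OF trig_poly_continuous[OF trig_poly_bump]] by blast

lemma bump_0: "bump 0 = 1" by (simp add: bump_def)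

lemma bump_factor: "0 \<le> (1 + cos (t::real)) / 2" "(1 + cos t) / 2 \<le> 1"
proof -
  have "0 \<le> 1 + cos t" using cos_ge_minus_one[of t] by linarith
  then show "0 \<le> (1 + cos t) / 2" by simp
  show "(1 + cos t) / 2 \<le> 1" by simp
qed

lemma bump_nonneg: "0 \<le> bump y"
  unfolding bump_def by (intro prod_nonneg bump_factor)

lemma bump_le_1: "bump y \<le> 1"
  unfolding bump_def by (intro prod_le_1 conjI bump_factor)

lemma bump_eq_1_Ints:
  assumes "bump y = 1"
  shows "y $ i \<in> \<int>"
proof -
  have "bump y = (1 + cos (2 * pi * y $ i)) / 2 * (\<Prod>j\<in>UNIV - {i}. (1 + cos (2 * pi * y $ j)) / 2)"
    unfolding bump_def by (subst prod.remove[of _ i]) auto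
  also have "\<dots> \<le> (1 + cos (2 * pi * y $ i)) / 2 * 1"
    by (intro mult_left_mono prod_le_1 conjI bump_factor)
  finally have "1 \<le> cos (2 * pi * y $ i)"
    using assms by simp
  then have "cos (2 * pi * y $ i) = 1"
    by (rule order_antisym[OF cos_le_one])
  then show ?thesis
    by (auto simp: cos_one_2pi_int)
qed

text \<open>
  Compactness: the points of the cube at distance at least \<open>\<delta>\<close> from the lattice form a compact
  set, where \<open>bump\<close> attains a maximum, and this maximum is not \<open>1\<close>.
\<close>

lemma bump_small_away_from_lattice:
  fixes \<delta> :: real
  assumes "0 < \<delta>"
  obtains \<eta> where "0 < \<eta>" "\<eta> \<le> 1"
    "\<And>y::real^'n. y \<in> unit_cube \<Longrightarrow> \<forall>k. (\<forall>i. k $ i \<in> \<int>) \<longrightarrow> \<delta> \<le> norm (y - k) \<Longrightarrow> bump y \<le> 1 - \<eta>"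
proof -
  let ?Z = "{k::real^'n. \<forall>i. k $ i \<in> \<int>}"
  let ?S = "(unit_cube :: (real^'n) set) \<inter> (\<Inter>k\<in>?Z. {y. \<delta> \<le> norm (y - k)})"
  have in_S: "y \<in> ?S" if "y \<in> unit_cube" "\<forall>k. (\<forall>i. k $ i \<in> \<int>) \<longrightarrow> \<delta> \<le> norm (y - k)" for y
    using that by blast
  have "closed (\<Inter>k\<in>?Z. {y. \<delta> \<le> norm (y - k)})"
    by (intro closed_INT ballI closed_Collect_le continuous_intros)
  then have comp: "compact ?S"
    by (intro compact_Int_closed compact_cbox)
  show thesis
  proof (cases "?S = {}")
    case True
    show ?thesis
    proof (rule that[of 1])
      fix y :: "real^'n"
      assume "y \<in> unit_cube" "\<forall>k. (\<forall>i. k $ i \<in> \<int>) \<longrightarrow> \<delta> \<le> norm (y - k)"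
      then have "y \<in> ?S" by (rule in_S)
      then have "y \<in> {}" unfolding True .
      then show "bump y \<le> 1 - 1" by (rule emptyE)
    qed simp_all
  next
    case False
    have "continuous_on ?S bump"
      by (rule continuous_on_subset[OF trig_poly_continuous[OF trig_poly_bump]]) (rule subset_UNIV)
    from continuous_attains_sup[OF comp False this]
    obtain y0 where y0: "y0 \<in> ?S" "\<forall>y\<in>?S. bump y \<le> bump y0" ..
    have "bump y0 \<noteq> 1"
    proof
      assume "bump y0 = 1"
      then have "y0 \<in> ?Z" by (simp add: bump_eq_1_Ints)
      then have "\<delta> \<le> norm (y0 - y0)" using y0(1) by blast
      with assms show False by simp
    qed
    then have lt: "bump y0 < 1" using bump_le_1[of y0] by simp
    show ?thesis
    proof (rule that[of "1 - bump y0"])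
      fix y :: "real^'n"
      assume "y \<in> unit_cube" "\<forall>k. (\<forall>i. k $ i \<in> \<int>) \<longrightarrow> \<delta> \<le> norm (y - k)"
      then have "y \<in> ?S" by (rule in_S)
      with y0(2) show "bump y \<le> 1 - (1 - bump y0)" by simp
    qed (use lt bump_nonneg[of y0] in simp_all)
  qed
qed

definition bump_mass :: "'n::finite itself \<Rightarrow> nat \<Rightarrow> real" where
  "bump_mass _ k = integral (unit_cube :: (real^'n) set) (\<lambda>y. bump y ^ k)"

lemma bump_power_integrable: "(\<lambda>y. bump y ^ k) integrable_on cbox a b"
  by (intro integrable_continuous continuous_on_power
      continuous_on_subset[OF trig_poly_continuous[OF trig_poly_bump]]) auto

text \<open>
  By continuity \<open>bump \<ge> r\<close> on a small box at the origin, whose volume serves as \<open>v\<close>.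
\<close>

lemma bump_mass_lower_bound:
  assumes "r < 1" "0 \<le> r"
  obtains v where "0 < v" "\<And>k. v * r ^ k \<le> bump_mass TYPE('n::finite) k"
proof -
  have "isCont (bump :: real^'n \<Rightarrow> real) 0"
    using continuous_on_eq_continuous_at[OF open_UNIV] trig_poly_continuous[OF trig_poly_bump] by blast
  then obtain d where d: "0 < d" "\<And>y::real^'n. norm y < d \<Longrightarrow> \<bar>bump y - 1\<bar> < 1 - r"
    using assms(1) by (auto simp: continuous_at_eps_delta bump_0 dist_norm)
      (metis diff_gt_0_iff_gt)
  define c where "c = min 1 (d / (2 * real CARD('n)))"
  have c: "0 < c" "c \<le> 1" "real CARD('n) * c < d"
    using d(1) by (auto simp: c_def min_def field_simps)
  let ?B = "cbox 0 (\<chi> i. c) :: (real^'n) set"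
  have sub: "?B \<subseteq> unit_cube"
    using c by (auto simp: mem_box_cart) (meson order_trans)
  have small: "r \<le> bump y" if "y \<in> ?B" for y
  proof -
    have "norm y \<le> (\<Sum>i\<in>UNIV. \<bar>y $ i\<bar>)" by (rule norm_le_l1_cart)
    also have "\<dots> \<le> (\<Sum>i::'n\<in>UNIV. c)"
      using that by (intro sum_mono) (auto simp: mem_box_cart)
    finally show ?thesis using d(2)[of y] c(3) by simp
  qed
  have v: "0 < measure lborel ?B"
    using c by (auto simp: content_pos_lt_eq Basis_vec_def inner_axis)
  have "measure lborel ?B * r ^ k \<le> bump_mass TYPE('n) k" for k
  proof -
    have "measure lborel ?B * r ^ k = integral ?B (\<lambda>y. r ^ k)" by simp
    also have "\<dots> \<le> integral ?B (\<lambda>y. bump y ^ k)"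
      by (intro integral_le bump_power_integrable integrable_const power_mono small assms)
    also have "\<dots> \<le> bump_mass TYPE('n) k"
      unfolding bump_mass_def
      by (intro integral_subset_le sub bump_power_integrable ballI zero_le_power bump_nonneg)
    finally show ?thesis .
  qed
  then show ?thesis using that v by blast
qed

lemma bump_mass_pos: "0 < bump_mass TYPE('n::finite) k"
proof -
  obtain v where "0 < v" "\<And>k. v * (1/2) ^ k \<le> bump_mass TYPE('n) k"
    using bump_mass_lower_bound[of "1/2"] by auto
  moreover have "0 < v * (1/2) ^ k" using \<open>0 < v\<close> by simp
  ultimately show ?thesis using less_le_trans by blast
qed

text \<open>
  Where \<open>bump \<le> q < 1\<close> the normalised powers tend to zero: compare \<open>q\<^sup>k\<close> with the lower bound
  \<open>v r\<^sup>k\<close> of the mass for some \<open>r\<close> strictly between \<open>q\<close> and \<open>1\<close>.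
\<close>

lemma bump_mass_dominates:
  assumes "0 \<le> q" "q < 1"
  shows "(\<lambda>k. q ^ k / bump_mass TYPE('n::finite) k) \<longlonglongrightarrow> 0"
proof -
  define r where "r = (1 + q) / 2"
  have r: "0 < r" "r < 1" "q < r" using assms by (auto simp: r_def)
  obtain v where v: "0 < v" "\<And>k. v * r ^ k \<le> bump_mass TYPE('n) k"
    using bump_mass_lower_bound[of r] r by auto
  let ?m = "bump_mass TYPE('n)"
  have "(\<lambda>k. (q / r) ^ k) \<longlonglongrightarrow> 0"
    by (rule LIMSEQ_power_zero) (use assms r in simp)
  then have lim: "(\<lambda>k. (q / r) ^ k / v) \<longlonglongrightarrow> 0"
    by (rule tendsto_divide_zero)
  have up: "q ^ k / ?m k \<le> (q / r) ^ k / v" for k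
  proof -
    have "q ^ k / ?m k \<le> q ^ k / (v * r ^ k)"
    proof (rule divide_left_mono[OF v(2)])
      show "0 \<le> q ^ k" using assms by simp
      show "0 < ?m k * (v * r ^ k)"
        using v(1) r(1) bump_mass_pos[where 'n='n, of k] by simp
    qed
    also have "\<dots> = (q / r) ^ k / v" by (simp add: power_divide)
    finally show ?thesis .
  qed
  have "0 \<le> q ^ k / ?m k" for k
    using assms less_imp_le[OF bump_mass_pos[where 'n='n, of k]] by simp
  then show ?thesis
    by (rule tendsto_sandwich[OF always_eventually[OF allI] always_eventually[OF allI] tendsto_const lim])
       (rule up)
qed

lemma content_unit_cube: "measure lborel (unit_cube :: (real^'n) set) = 1"
proof -
  have "(unit_cube :: (real^'n) set) \<noteq> {}" by (simp add: interval_ne_empty_cart)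
  then show ?thesis by (simp add: content_cbox_cart)
qed

definition mollify :: "nat \<Rightarrow> (real^'n \<Rightarrow> real) \<Rightarrow> real^'n \<Rightarrow> real" where
  "mollify k f x = integral unit_cube (\<lambda>y. f (x - y) * bump y ^ k) / bump_mass TYPE('n) k"

lemma periodic_cube_representative:
  fixes x :: "real^'n"
  obtains y k where "y \<in> unit_cube" "\<And>i. k $ i \<in> \<int>" "x = y + k"
proof
  show "(\<chi> i. frac (x $ i)) \<in> (unit_cube :: (real^'n) set)"
    by (auto simp: mem_box_cart less_imp_le frac_lt_1)
  show "(\<chi> i. of_int \<lfloor>x $ i\<rfloor>) $ i \<in> \<int>" for i :: 'n by simp
  show "x = (\<chi> i. frac (x $ i)) + (\<chi> i. of_int \<lfloor>x $ i\<rfloor>)"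
    by (simp add: vec_eq_iff frac_def)
qed

lemma periodic_image:
  fixes f :: "real^'n \<Rightarrow> 'b"
  assumes per: "periodic f"
  shows "range f = f ` unit_cube"
proof
  show "range f \<subseteq> f ` unit_cube"
  proof clarify
    fix x :: "real^'n"
    obtain y k where "y \<in> unit_cube" "\<And>i. k $ i \<in> \<int>" "x = y + k"
      using periodic_cube_representative by blast
    then have "f x = f y" "y \<in> unit_cube" using periodicD[OF per] by simp_all
    then show "f x \<in> f ` unit_cube" by (rule image_eqI)
  qed
qed auto

lemma periodic_bounded:
  fixes f :: "real^'n \<Rightarrow> real"
  assumes "periodic f" "continuous_on UNIV f"
  obtains M where "0 \<le> M" "\<And>x. \<bar>f x\<bar> \<le> M"
proof -
  have "bounded (range f)"
    unfolding periodic_image[OF assms(1)]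
    by (intro compact_imp_bounded compact_continuous_image continuous_on_subset[OF assms(2)]) auto
  then obtain M where "\<And>x. \<bar>f x\<bar> \<le> M" unfolding bounded_iff by auto
  then show ?thesis using that[of M] by (meson abs_ge_zero order_trans)
qed

lemma periodic_uniformly_continuous:
  fixes f :: "real^'n \<Rightarrow> real"
  assumes per: "periodic f" and cont: "continuous_on UNIV f" and "0 < e"
  obtains \<delta> where "0 < \<delta>" "\<And>x z. norm z < \<delta> \<Longrightarrow> \<bar>f (x - z) - f x\<bar> < e"
proof -
  let ?B = "cbox (-1) 2 :: (real^'n) set"
  have "uniformly_continuous_on ?B f"
    by (intro compact_uniformly_continuous continuous_on_subset[OF cont]) auto
  then obtain d where d: "0 < d" "\<And>x x'. x \<in> ?B \<Longrightarrow> x' \<in> ?B \<Longrightarrow> dist x' x < d \<Longrightarrow> dist (f x') (f x) < e"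
    using \<open>0 < e\<close> by (rule uniformly_continuous_onE) blast
  show thesis
  proof (rule that[of "min d 1"])
    fix x z :: "real^'n" assume z: "norm z < min d 1"
    obtain y k where y: "y \<in> unit_cube" "\<And>i. k $ i \<in> \<int>" "x = y + k"
      using periodic_cube_representative by blast
    have zi: "\<bar>z $ i\<bar> \<le> 1" for i
      using component_le_norm_cart[of z i] z by simp
    have "y \<in> ?B" "y - z \<in> ?B"
    proof -
      have "0 \<le> y $ i" "y $ i \<le> 1" for i using y(1) by (simp_all add: mem_box_cart)
      then have "- 1 \<le> y $ i \<and> y $ i \<le> 2" "- 1 \<le> y $ i - z $ i \<and> y $ i - z $ i \<le> 2" for i
        using zi[of i] by (smt (verit))+
      then show "y \<in> ?B" "y - z \<in> ?B" by (simp_all add: mem_box_cart)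
    qed
    then have "\<bar>f (y - z) - f y\<bar> < e"
      using d(2)[of y "y - z"] z by (simp add: dist_norm)
    moreover have "f (x - z) = f (y - z)"
      using periodicD[OF per y(2), of "y - z"] y(3) by (simp add: algebra_simps)
    moreover have "f x = f y" using periodicD[OF per y(2)] y(3) by simp
    ultimately show "\<bar>f (x - z) - f x\<bar> < e" by simp
  qed (use d in auto)
qed

text \<open>
  The usual argument for approximate identities. Near the lattice \<open>f (x - y)\<close> is close to \<open>f x\<close>,
  by uniform continuity and periodicity; elsewhere the kernel is uniformly small.
\<close>

lemma mollify_uniform_limit:
  fixes f :: "real^'n \<Rightarrow> real"
  assumes per: "periodic f" and cont: "continuous_on UNIV f"
  shows "uniform_limit UNIV (\<lambda>k. mollify k f) f sequentially"
proof (rule uniform_limitI)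
  fix e :: real assume e: "0 < e"
  obtain M where M: "0 \<le> M" "\<And>x. \<bar>f x\<bar> \<le> M" using periodic_bounded[OF per cont] by blast
  obtain \<delta> where \<delta>: "0 < \<delta>" "\<And>x z. norm z < \<delta> \<Longrightarrow> \<bar>f (x - z) - f x\<bar> < e / 2"
    using periodic_uniformly_continuous[OF per cont, of "e/2"] e by auto
  obtain \<eta> where \<eta>: "0 < \<eta>" "\<eta> \<le> 1" "\<And>y::real^'n. y \<in> unit_cube \<Longrightarrow>
      \<forall>k. (\<forall>i. k $ i \<in> \<int>) \<longrightarrow> \<delta> \<le> norm (y - k) \<Longrightarrow> bump y \<le> 1 - \<eta>"
    using bump_small_away_from_lattice[OF \<delta>(1)] by blast
  have ptw: "\<bar>f (x - y) - f x\<bar> * bump y ^ k \<le> e / 2 * bump y ^ k + 2 * M * (1 - \<eta>) ^ k"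
    if y: "y \<in> unit_cube" for x y k
  proof (cases "\<exists>l. (\<forall>i. l $ i \<in> \<int>) \<and> norm (y - l) < \<delta>")
    case True
    then obtain l where l: "\<And>i. l $ i \<in> \<int>" "norm (y - l) < \<delta>" by blast
    have "f (x - y) = f (x - (y - l))"
      using periodicD[OF per, of l "x - y"] l(1) by (simp add: algebra_simps)
    then have "\<bar>f (x - y) - f x\<bar> \<le> e / 2" using \<delta>(2)[OF l(2), of x] by simp
    then have "\<bar>f (x - y) - f x\<bar> * bump y ^ k \<le> e / 2 * bump y ^ k"
      by (intro mult_right_mono zero_le_power bump_nonneg)
    moreover have "0 \<le> 2 * M * (1 - \<eta>) ^ k" using M \<eta> by simp
    ultimately show ?thesis by linarith
  next
    case False
    then have "bump y \<le> 1 - \<eta>" by (intro \<eta>(3) y) (auto simp: not_less)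
    moreover have "\<bar>f (x - y) - f x\<bar> \<le> 2 * M" using M(2)[of x] M(2)[of "x - y"] by linarith
    ultimately have "\<bar>f (x - y) - f x\<bar> * bump y ^ k \<le> 2 * M * (1 - \<eta>) ^ k"
      by (intro mult_mono power_mono bump_nonneg zero_le_power) (use M in auto)
    moreover have "0 \<le> e / 2 * bump y ^ k" using e bump_nonneg[of y] by simp
    ultimately show ?thesis by linarith
  qed
  have bump_cont: "continuous_on S (\<lambda>y::real^'n. bump y ^ k)" for S k
    by (intro continuous_on_power continuous_on_subset[OF trig_poly_continuous[OF trig_poly_bump]]) simp
  have f_cont: "continuous_on S (\<lambda>y. f (x - y))" for S x
    by (rule continuous_on_compose2[OF cont]) (auto intro!: continuous_intros)
  have bound: "\<bar>mollify k f x - f x\<bar> \<le> e / 2 + 2 * M * ((1 - \<eta>) ^ k / bump_mass TYPE('n) k)" for k x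
  proof -
    let ?m = "bump_mass TYPE('n) k"
    have m: "0 < ?m" by (rule bump_mass_pos)
    have "integral unit_cube (\<lambda>y. (f (x - y) - f x) * bump y ^ k) =
        integral unit_cube (\<lambda>y. f (x - y) * bump y ^ k) - integral unit_cube (\<lambda>y::real^'n. f x * bump y ^ k)"
      unfolding left_diff_distrib
      by (intro Henstock_Kurzweil_Integration.integral_diff integrable_continuous continuous_on_mult bump_cont f_cont continuous_on_const)
    then have "integral unit_cube (\<lambda>y. f (x - y) * bump y ^ k) - f x * ?m =
        integral unit_cube (\<lambda>y. (f (x - y) - f x) * bump y ^ k)"
      unfolding bump_mass_def by simp
    also have "\<bar>\<dots>\<bar> \<le> integral unit_cube (\<lambda>y::real^'n. e / 2 * bump y ^ k + 2 * M * (1 - \<eta>) ^ k)"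
      unfolding real_norm_def[symmetric]
    proof (rule integral_norm_bound_integral)
      show "(\<lambda>y. (f (x - y) - f x) * bump y ^ k) integrable_on unit_cube"
        by (intro integrable_continuous continuous_on_mult continuous_on_diff bump_cont f_cont continuous_on_const)
      show "(\<lambda>y::real^'n. e / 2 * bump y ^ k + 2 * M * (1 - \<eta>) ^ k) integrable_on unit_cube"
        by (intro integrable_continuous continuous_on_mult continuous_on_add bump_cont continuous_on_const)
      show "norm ((f (x - y) - f x) * bump y ^ k) \<le> e / 2 * bump y ^ k + 2 * M * (1 - \<eta>) ^ k"
        if "y \<in> unit_cube" for y
        using ptw[OF that] by (simp add: abs_mult bump_nonneg)
    qed
    also have "\<dots> = integral unit_cube (\<lambda>y::real^'n. e / 2 * bump y ^ k) + integral (unit_cube :: (real^'n) set) (\<lambda>y. 2 * M * (1 - \<eta>) ^ k)"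
      by (intro integral_add integrable_continuous continuous_on_mult bump_cont continuous_on_const)
    also have "\<dots> = e / 2 * ?m + 2 * M * (1 - \<eta>) ^ k"
      unfolding bump_mass_def by (simp add: content_unit_cube)
    also have "\<dots> = (e / 2 + 2 * M * ((1 - \<eta>) ^ k / ?m)) * ?m"
      using m by (simp add: distrib_right)
    finally have "\<bar>integral unit_cube (\<lambda>y. f (x - y) * bump y ^ k) - f x * ?m\<bar> / ?m \<le>
        e / 2 + 2 * M * ((1 - \<eta>) ^ k / ?m)"
      using m by (simp only: pos_divide_le_eq)
    moreover have "mollify k f x - f x = (integral unit_cube (\<lambda>y. f (x - y) * bump y ^ k) - f x * ?m) / ?m"
      using m by (simp add: mollify_def diff_divide_distrib)
    ultimately show ?thesis using m by (simp add: abs_divide)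
  qed
  have "(\<lambda>k. 2 * M * ((1 - \<eta>) ^ k / bump_mass TYPE('n) k)) \<longlonglongrightarrow> 0"
    using \<eta> by (intro tendsto_mult_right_zero bump_mass_dominates) auto
  then have "\<forall>\<^sub>F k in sequentially. 2 * M * ((1 - \<eta>) ^ k / bump_mass TYPE('n) k) < e / 2"
    using e by (intro order_tendstoD(2)) auto
  then show "\<forall>\<^sub>F k in sequentially. \<forall>x\<in>UNIV. dist (mollify k f x) (f x) < e"
  proof eventually_elim
    case (elim k)
    show ?case
    proof
      fix x
      show "dist (mollify k f x) (f x) < e"
        using bound[of k x] elim unfolding dist_real_def by linarith
    qed
  qed
qed

text \<open>
  The substitution \<open>y \<mapsto> x - y\<close> moves the variable \<open>x\<close> from \<open>f\<close>, which is only continuous, to the kernel.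
\<close>

lemma trig_poly_mollify:
  fixes f :: "real^'n \<Rightarrow> real"
  assumes per: "periodic f" and cont: "continuous_on UNIV f"
  shows "trig_poly (mollify k f)"
proof -
  have "integral unit_cube (\<lambda>y. f (x - y) * bump y ^ k) = integral unit_cube (\<lambda>y. f y * bump (x - y) ^ k)" for x
  proof -
    have "periodic (\<lambda>y. f (x - y) * bump y ^ k)"
    proof -
      have "f (x - (y + l)) = f (x - y)" if "\<forall>i. l $ i \<in> \<int>" for y l
        using periodicD[OF per, of l "x - (y + l)"] that by simp
      moreover have "bump (y + l) = bump y" if "\<forall>i. l $ i \<in> \<int>" for y l :: "real^'n"
        using periodicD[OF trig_poly_periodic[OF trig_poly_bump], of l y] that by simp
      ultimately show ?thesis by (simp add: periodic_def)
    qed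
    then have "integral unit_cube (\<lambda>y. f (x - (x - y)) * bump (x - y) ^ k) =
        integral unit_cube (\<lambda>y. f (x - y) * bump y ^ k)"
      by (rule integral_cube_reflect)
         (auto intro!: continuous_intros trig_poly_continuous[OF trig_poly_bump] continuous_on_compose2[OF cont])
    then show ?thesis by simp
  qed
  then have "mollify k f = (\<lambda>x. (1 / bump_mass TYPE('n) k) * integral unit_cube (\<lambda>y. f y * bump (x - y) ^ k))"
    by (auto simp: mollify_def)
  then show ?thesis
    by (simp only:) (intro trig_poly.intros trig_poly_convolution trig_poly_power trig_poly_bump cont)
qed

section \<open>Gradients and derivatives of mollified functions\<close>

lemma dir_deriv_eq: "(f has_derivative D) (at x) \<Longrightarrow> dir_deriv b f x = D b"
  by (metis dir_deriv_def frechet_derivative_at)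

lemma grad_inner_Basis: "b \<in> Basis \<Longrightarrow> grad f x \<bullet> b = dir_deriv b f x"
  by (simp add: grad_def inner_sum_left inner_Basis if_distrib cong: if_cong)

lemma inner_grad: "v \<bullet> grad f x = (\<Sum>b\<in>Basis. (v \<bullet> b) * dir_deriv b f x)"
  by (subst euclidean_inner) (simp add: grad_inner_Basis)

lemma has_derivative_grad:
  assumes "f differentiable (at x)"
  shows "(f has_derivative (\<lambda>v. grad f x \<bullet> v)) (at x)"
proof -
  obtain D where D: "(f has_derivative D) (at x)" using assms differentiable_def by blast
  have "D v = grad f x \<bullet> v" for v
  proof -
    interpret bounded_linear D using D by (rule has_derivative_bounded_linear)
    have "D v = D (\<Sum>b\<in>Basis. (v \<bullet> b) *\<^sub>R b)" by (simp add: euclidean_representation)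
    also have "\<dots> = (\<Sum>b\<in>Basis. (v \<bullet> b) * D b)" by (simp add: sum scaleR)
    also have "\<dots> = v \<bullet> grad f x" by (simp add: inner_grad dir_deriv_eq[OF D])
    finally show ?thesis by (simp add: inner_commute)
  qed
  then have "D = (\<lambda>v. grad f x \<bullet> v)" by auto
  with D show ?thesis by simp
qed

lemma has_derivative_translate:
  fixes f :: "'a::euclidean_space \<Rightarrow> real"
  assumes "\<And>x. f differentiable (at x)"
  shows "((\<lambda>x. f (x + a)) has_derivative (\<lambda>v. grad f (x + a) \<bullet> v)) (at x)"
proof -
  have "((\<lambda>x. x + a) has_derivative (\<lambda>v. v)) (at x)"
    by (auto intro!: derivative_eq_intros)
  from has_derivative_compose[OF this has_derivative_grad[OF assms]] show ?thesis .
qed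

lemma Ck_1_iff: "Ck 1 f \<longleftrightarrow> (\<forall>x. f differentiable (at x)) \<and> (\<forall>b\<in>Basis. continuous_on UNIV (dir_deriv b f))"
  by (simp add: One_nat_def)

lemma Ck_2_iff: "Ck 2 f \<longleftrightarrow> (\<forall>x. f differentiable (at x)) \<and> (\<forall>b\<in>Basis. Ck 1 (dir_deriv b f))"
  by (simp add: numeral_2_eq_2 One_nat_def)

lemma Ck_1_continuous: "Ck 1 f \<Longrightarrow> continuous_on UNIV f"
  by (simp add: Ck_1_iff differentiable_imp_continuous_on differentiable_on_def)

lemma Ck_2_imp_1: "Ck 2 f \<Longrightarrow> Ck 1 f"
  by (simp add: Ck_2_iff Ck_1_iff[of f] Ck_1_continuous)

lemma Ck_1_grad_continuous: "Ck 1 f \<Longrightarrow> continuous_on UNIV (grad f)"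
  unfolding grad_def[abs_def] by (intro continuous_intros) (simp add: Ck_1_iff)

lemma periodic_dir_deriv:
  fixes f :: "real^'n \<Rightarrow> real"
  assumes per: "periodic f" and diff: "\<And>x. f differentiable (at x)"
  shows "periodic (dir_deriv b f)"
  unfolding periodic_def
proof (intro allI impI)
  fix x k :: "real^'n" assume k: "\<forall>i. k $ i \<in> \<int>"
  have "(\<lambda>x. f (x + k)) = f" using periodicD[OF per] k by auto
  moreover have "((\<lambda>x. f (x + k)) has_derivative (\<lambda>v. grad f (x + k) \<bullet> v)) (at x)"
    by (rule has_derivative_translate[OF diff])
  ultimately have "(f has_derivative (\<lambda>v. grad f (x + k) \<bullet> v)) (at x)" by simp
  then have "dir_deriv b f x = grad f (x + k) \<bullet> b" by (rule dir_deriv_eq)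
  moreover have "dir_deriv b f (x + k) = grad f (x + k) \<bullet> b"
    by (rule dir_deriv_eq[OF has_derivative_grad[OF diff]])
  ultimately show "dir_deriv b f (x + k) = dir_deriv b f x" by simp
qed

text \<open>
  Mollification commutes with differentiation. Applied twice, it turns uniform convergence of
  mollified continuous functions into convergence of second derivatives.
\<close>

lemma dir_deriv_mollify:
  fixes f :: "real^'n \<Rightarrow> real"
  assumes f: "Ck 1 f" and b: "b \<in> Basis"
  shows "dir_deriv b (mollify k f) = mollify k (dir_deriv b f)"
proof
  fix x :: "real^'n"
  define F where "F x y = (bump y ^ k) *\<^sub>R blinfun_inner_right (grad f (x - y))" for x y :: "real^'n"
  have diff: "f differentiable (at x)" for x using f by (simp add: Ck_1_iff)
  have fc: "continuous_on S f" for S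
    using Ck_1_continuous[OF f] continuous_on_subset by blast
  have gc: "continuous_on UNIV (grad f)" by (rule Ck_1_grad_continuous[OF f])
  have Fc: "continuous_on S (\<lambda>z. F (fst z) (snd z))" for S
    unfolding F_def
    by (intro continuous_on_scaleR continuous_on_power continuous_on_compose2[OF bump_continuous[of UNIV]]
          bounded_linear.continuous_on[OF bounded_linear_blinfun_inner_right]
          continuous_on_compose2[OF gc] continuous_intros) auto
  have Fxc: "continuous_on S (F x)" for x S
    using continuous_on_compose2[OF Fc[of UNIV], of S "\<lambda>y. (x, y)"]
    by (simp add: continuous_on_Pair continuous_on_const continuous_on_id)
  have "((\<lambda>x. integral unit_cube (\<lambda>y. f (x - y) * bump y ^ k)) has_derivative
      blinfun_apply (integral unit_cube (F x))) (at x within UNIV)"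
  proof (rule leibniz_rule)
    fix x y :: "real^'n"
    have "((\<lambda>x. f (x - y)) has_derivative (\<lambda>v. grad f (x - y) \<bullet> v)) (at x)"
      using has_derivative_translate[OF diff, where a = "- y" and x = x] by simp
    then have "((\<lambda>x. f (x - y) * bump y ^ k) has_derivative (\<lambda>v. (grad f (x - y) \<bullet> v) * bump y ^ k)) (at x)"
      by (rule has_derivative_mult_left)
    moreover have "blinfun_apply (F x y) = (\<lambda>v. (grad f (x - y) \<bullet> v) * bump y ^ k)"
      by (auto simp: F_def scaleR_blinfun.rep_eq)
    ultimately show "((\<lambda>x. f (x - y) * bump y ^ k) has_derivative blinfun_apply (F x y)) (at x within UNIV)"
      by simp
  next
    fix x :: "real^'n"
    show "(\<lambda>y. f (x - y) * bump y ^ k) integrable_on unit_cube"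
      by (intro integrable_continuous continuous_on_mult continuous_on_power bump_continuous
            continuous_on_compose2[OF fc[of UNIV]] continuous_intros) auto
  next
    show "continuous_on (UNIV \<times> unit_cube) (\<lambda>(x, y). F x y)"
      using Fc by (simp add: case_prod_unfold)
  qed auto
  then have "((\<lambda>x. mollify k f x) has_derivative (\<lambda>v. blinfun_apply (integral unit_cube (F x)) v / bump_mass TYPE('n) k)) (at x)"
    unfolding mollify_def divide_inverse by (intro has_derivative_mult_left) simp
  then have "dir_deriv b (mollify k f) x = blinfun_apply (integral unit_cube (F x)) b / bump_mass TYPE('n) k"
    by (rule dir_deriv_eq)
  also have "blinfun_apply (integral unit_cube (F x)) b = integral unit_cube (\<lambda>y. blinfun_apply (F x y) b)"
    by (rule blinfun_apply_integral) (intro integrable_continuous Fxc)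
  also have "\<dots> = integral unit_cube (\<lambda>y. dir_deriv b f (x - y) * bump y ^ k)"
    using b by (simp add: F_def scaleR_blinfun.rep_eq grad_inner_Basis mult.commute)
  finally show "dir_deriv b (mollify k f) x = mollify k (dir_deriv b f) x"
    unfolding mollify_def[of k "dir_deriv b f"] .
qed

section \<open>The Fokker-Planck equation tested with the solution\<close>

lemma continuous_cube_integral:
  fixes f :: "real^'n \<Rightarrow> 'b::euclidean_space"
  assumes "continuous_on UNIV f"
  shows "f integrable_on unit_cube" "set_integrable lebesgue unit_cube f"
    "(LINT x:unit_cube|lebesgue. f x) = integral unit_cube f"
proof -
  have c: "continuous_on unit_cube f" using assms continuous_on_subset by blast
  show "f integrable_on unit_cube" by (rule integrable_continuous[OF c])
  show s: "set_integrable lebesgue unit_cube f" by (rule absolutely_integrable_continuous[OF c])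
  show "(LINT x:unit_cube|lebesgue. f x) = integral unit_cube f"
    by (rule set_lebesgue_integral_eq_integral(2)[OF s])
qed

lemma Lp_torus_1_mult_continuous:
  fixes f g :: "real^'n \<Rightarrow> real"
  assumes f: "Lp_torus 1 f" and g: "continuous_on UNIV g"
  shows "set_integrable lebesgue unit_cube (\<lambda>x. f x * g x)"
proof -
  have gc: "continuous_on unit_cube g" using g continuous_on_subset by blast
  have m: "f \<in> borel_measurable lebesgue" and i: "set_integrable lebesgue unit_cube (\<lambda>x. \<bar>f x\<bar>)"
    using f by (simp_all add: Lp_torus_def)
  have "integrable lebesgue (\<lambda>x. indicator unit_cube x *\<^sub>R f x)"
  proof (rule Bochner_Integration.integrable_bound)
    show "integrable lebesgue (\<lambda>x. indicator unit_cube x *\<^sub>R \<bar>f x\<bar>)"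
      using i by (simp add: set_integrable_def)
    show "(\<lambda>x. indicator unit_cube x *\<^sub>R f x) \<in> borel_measurable lebesgue"
      using m by (intro borel_measurable_scaleR borel_measurable_indicator) auto
    show "AE x in lebesgue. norm (indicator unit_cube x *\<^sub>R f x) \<le> norm (indicator unit_cube x *\<^sub>R \<bar>f x\<bar>)"
      by (simp add: abs_mult)
  qed
  then have "f absolutely_integrable_on unit_cube" by (simp add: set_integrable_def)
  moreover have "g \<in> borel_measurable (lebesgue_on unit_cube)"
    by (rule continuous_imp_measurable_on_sets_lebesgue[OF gc]) simp
  moreover have "bounded (g ` unit_cube)"
    by (rule compact_imp_bounded[OF compact_continuous_image[OF gc compact_cbox]])
  ultimately have "(\<lambda>x. g x * f x) absolutely_integrable_on unit_cube"
    by (intro absolutely_integrable_bounded_measurable_product[OF bilinear_times]) simp_all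
  then show ?thesis by (simp add: mult.commute)
qed

text \<open>
  Both sides are equal to minus the sum of the integrals of \<open>(G \<bullet> b) * dir_deriv b \<phi>\<close>, where \<open>G\<close> is the
  weak gradient of \<open>m\<close>: on the left by the Fokker-Planck equation tested with \<open>\<phi>\<close>, on the right by
  the definition of \<open>G\<close> tested with the derivatives of \<open>\<phi>\<close>. The result no longer mentions \<open>G\<close>.
\<close>

lemma dual_equation_trig_poly:
  fixes u m :: "real^'n \<Rightarrow> real"
  assumes fp: "weak_fokker_planck P u m"
    and m: "continuous_on UNIV m" and gu: "continuous_on UNIV (grad u)"
    and \<phi>: "trig_poly \<phi>"
  shows "(\<Sum>b\<in>Basis. integral unit_cube (\<lambda>x. (m x * ((grad u x + P) \<bullet> b)) * dir_deriv b \<phi> x)) =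
         (\<Sum>b\<in>Basis. integral unit_cube (\<lambda>x. m x * dir_deriv b (dir_deriv b \<phi>) x))"
proof -
  obtain G where G: "weak_gradient m G"
    and eq: "\<And>\<phi>. smooth \<phi> \<Longrightarrow> periodic \<phi> \<Longrightarrow>
      (LINT x:unit_cube|lebesgue. (G x + m x *\<^sub>R (grad u x + P)) \<bullet> grad \<phi> x) = 0"
    using fp unfolding weak_fokker_planck_def by blast
  have d: "trig_poly (dir_deriv b \<phi>)" for b using \<phi> by (rule trig_poly_dir_deriv)
  have dc: "continuous_on UNIV (dir_deriv b \<phi>)" for b by (rule trig_poly_continuous[OF d])
  have ddc: "continuous_on UNIV (dir_deriv b (dir_deriv b \<phi>))" for b
    by (rule trig_poly_continuous[OF trig_poly_dir_deriv(2)[OF d]])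
  let ?A = "\<lambda>b x. (G x \<bullet> b) * dir_deriv b \<phi> x"
  let ?B = "\<lambda>b x. (m x * ((grad u x + P) \<bullet> b)) * dir_deriv b \<phi> x"
  let ?D = "\<lambda>b x. m x * dir_deriv b (dir_deriv b \<phi>) x"
  have Ai: "set_integrable lebesgue unit_cube (?A b)" if "b \<in> Basis" for b
    using G that by (intro Lp_torus_1_mult_continuous dc) (simp add: weak_gradient_def)
  note Ai' = set_lebesgue_integral_eq_integral[OF Ai]
  have Bc: "continuous_on UNIV (?B b)" for b
    by (intro continuous_on_mult m dc continuous_on_inner continuous_on_add gu continuous_on_const)
  have Bi: "set_integrable lebesgue unit_cube (?B b)" "?B b integrable_on unit_cube" for b
    using continuous_cube_integral[OF Bc] by blast+
  have Dc: "continuous_on UNIV (?D b)" for b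
    by (intro continuous_on_mult m ddc)
  have parts: "integral unit_cube (?D b) = - integral unit_cube (?A b)" if b: "b \<in> Basis" for b
  proof -
    have "(LINT x:unit_cube|lebesgue. ?D b x) = - (LINT x:unit_cube|lebesgue. ?A b x)"
      using G b trig_poly_smooth[OF d] trig_poly_periodic[OF d] unfolding weak_gradient_def by simp
    then show ?thesis using continuous_cube_integral(3)[OF Dc] Ai'(2)[OF b] by simp
  qed
  have "(LINT x:unit_cube|lebesgue. (G x + m x *\<^sub>R (grad u x + P)) \<bullet> grad \<phi> x) =
      (LINT x:unit_cube|lebesgue. (\<Sum>b\<in>Basis. ?A b x + ?B b x))"
    by (simp add: inner_grad inner_add_left distrib_right distrib_left mult.assoc)
  also have "\<dots> = integral unit_cube (\<lambda>x. \<Sum>b\<in>Basis. ?A b x + ?B b x)"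
    by (intro set_lebesgue_integral_eq_integral absolutely_integrable_sum set_integral_add Ai Bi) simp
  also have "\<dots> = (\<Sum>b\<in>Basis. integral unit_cube (\<lambda>x. ?A b x + ?B b x))"
    by (rule integral_sum) (auto intro!: integrable_add Ai' Bi)
  also have "\<dots> = (\<Sum>b\<in>Basis. integral unit_cube (?A b) + integral unit_cube (?B b))"
    by (rule sum.cong[OF refl]) (rule integral_add[OF Ai'(1) Bi(2)])
  finally have "(\<Sum>b\<in>Basis. integral unit_cube (?A b) + integral unit_cube (?B b)) = 0"
    using eq[OF trig_poly_smooth[OF \<phi>] trig_poly_periodic[OF \<phi>]] by simp
  moreover have "(\<Sum>b\<in>Basis. integral unit_cube (?D b)) = (\<Sum>b\<in>Basis. - integral unit_cube (?A b))"
    by (rule sum.cong[OF refl]) (rule parts)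
  ultimately show ?thesis by (simp add: sum.distrib sum_negf)
qed

lemma uniform_limit_weighted_integral:
  fixes w :: "real^'n \<Rightarrow> real"
  assumes w: "continuous_on UNIV w" and lim: "uniform_limit UNIV f g sequentially"
    and f: "\<And>k. continuous_on UNIV (f k)" and g: "continuous_on UNIV g"
  shows "(\<lambda>k. integral unit_cube (\<lambda>x. w x * f k x)) \<longlonglongrightarrow> integral unit_cube (\<lambda>x. w x * g x)"
proof -
  have bdd: "bounded (h ` unit_cube)" if "continuous_on UNIV h" for h :: "real^'n \<Rightarrow> real"
    by (rule compact_imp_bounded[OF compact_continuous_image[OF continuous_on_subset[OF that] compact_cbox]]) simp
  have "uniform_limit unit_cube (\<lambda>k x. w x * f k x) (\<lambda>x. w x * g x) sequentially"
    by (rule uniform_lim_mult[OF uniform_limit_const uniform_limit_on_subset[OF lim] bdd[OF w] bdd[OF g]]) simp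
  moreover have "continuous_on unit_cube (\<lambda>x. w x * f k x)" for k
    by (rule continuous_on_subset[OF continuous_on_mult[OF w f]]) simp
  ultimately obtain I J where IJ: "\<And>k. ((\<lambda>x. w x * f k x) has_integral I k) unit_cube"
    "((\<lambda>x. w x * g x) has_integral J) unit_cube" "I \<longlonglongrightarrow> J"
    by (rule uniform_limit_integral_cbox[OF _ _ sequentially_bot]) (rule that)
  have "integral unit_cube (\<lambda>x. w x * f k x) = I k" for k
    by (rule integral_unique[OF IJ(1)])
  moreover have "integral unit_cube (\<lambda>x. w x * g x) = J"
    by (rule integral_unique[OF IJ(2)])
  ultimately show ?thesis using IJ(3) by simp
qed

text \<open>
  The solution \<open>u\<close> itself is admissible as a test function. It is only \<open>C\<^sup>2\<close>, but its mollifications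
  are trigonometric polynomials that converge to it uniformly together with their first and second
  derivatives, and the identity involves no other derivatives.
\<close>

lemma dual_equation:
  fixes u m :: "real^'n \<Rightarrow> real"
  assumes fp: "weak_fokker_planck P u m" and m: "continuous_on UNIV m"
    and per: "periodic u" and u: "Ck 2 u"
  shows "integral unit_cube (\<lambda>x. m x * ((grad u x + P) \<bullet> grad u x)) =
         integral unit_cube (\<lambda>x. m x * laplacian u x)"
proof -
  have u1: "Ck 1 u" and du1: "\<And>b. b \<in> Basis \<Longrightarrow> Ck 1 (dir_deriv b u)"
    using u Ck_2_imp_1 Ck_2_iff by blast+
  have gu: "continuous_on UNIV (grad u)" by (rule Ck_1_grad_continuous[OF u1])
  have dc: "continuous_on UNIV (dir_deriv b u)" if "b \<in> Basis" for b
    using Ck_1_continuous[OF du1[OF that]] .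
  have ddc: "continuous_on UNIV (dir_deriv b (dir_deriv b u))" if "b \<in> Basis" for b
    using du1[OF that] that Ck_1_iff by blast
  have dper: "periodic (dir_deriv b u)" for b
    using u1 by (intro periodic_dir_deriv per) (simp add: Ck_1_iff)
  have ddper: "periodic (dir_deriv b (dir_deriv b u))" if "b \<in> Basis" for b
    using du1[OF that] by (intro periodic_dir_deriv dper) (simp add: Ck_1_iff)
  let ?w = "\<lambda>b x. m x * ((grad u x + P) \<bullet> b)"
  have wc: "continuous_on UNIV (?w b)" for b
    by (intro continuous_on_mult m continuous_on_inner continuous_on_add gu continuous_on_const)
  have moll_c: "continuous_on UNIV (mollify k f)" if "periodic f" "continuous_on UNIV f" for k and f :: "real^'n \<Rightarrow> real"
    by (rule trig_poly_continuous[OF trig_poly_mollify[OF that]])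
  let ?L = "\<lambda>k. \<Sum>b\<in>Basis. integral unit_cube (\<lambda>x. ?w b x * mollify k (dir_deriv b u) x)"
  let ?R = "\<lambda>k. \<Sum>b\<in>Basis. integral unit_cube (\<lambda>x. m x * mollify k (dir_deriv b (dir_deriv b u)) x)"
  have "?L k = ?R k" for k
  proof -
    have d: "dir_deriv b (mollify k u) = mollify k (dir_deriv b u)" if "b \<in> Basis" for b
      by (rule dir_deriv_mollify[OF u1 that])
    have dd: "dir_deriv b (dir_deriv b (mollify k u)) = mollify k (dir_deriv b (dir_deriv b u))" if "b \<in> Basis" for b
      unfolding d[OF that] by (rule dir_deriv_mollify[OF du1[OF that] that])
    have "trig_poly (mollify k u)"
      by (rule trig_poly_mollify[OF per Ck_1_continuous[OF u1]])
    note dual_equation_trig_poly[OF fp m gu this]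
    moreover have "(\<Sum>b\<in>Basis. integral unit_cube (\<lambda>x. ?w b x * dir_deriv b (mollify k u) x)) = ?L k"
      by (rule sum.cong[OF refl]) (simp only: d)
    moreover have "(\<Sum>b\<in>Basis. integral unit_cube (\<lambda>x. m x * dir_deriv b (dir_deriv b (mollify k u)) x)) = ?R k"
      by (rule sum.cong[OF refl]) (simp only: dd)
    ultimately show ?thesis by simp
  qed
  moreover have "?L \<longlonglongrightarrow> (\<Sum>b\<in>Basis. integral unit_cube (\<lambda>x. ?w b x * dir_deriv b u x))"
    by (intro tendsto_sum uniform_limit_weighted_integral mollify_uniform_limit moll_c wc dc dper)
  moreover have "?R \<longlonglongrightarrow> (\<Sum>b\<in>Basis. integral unit_cube (\<lambda>x. m x * dir_deriv b (dir_deriv b u) x))"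
    by (intro tendsto_sum uniform_limit_weighted_integral mollify_uniform_limit moll_c m ddc ddper)
  ultimately have "(\<Sum>b\<in>Basis. integral unit_cube (\<lambda>x. ?w b x * dir_deriv b u x)) =
      (\<Sum>b\<in>Basis. integral unit_cube (\<lambda>x. m x * dir_deriv b (dir_deriv b u) x))"
    using LIMSEQ_unique by simp
  moreover have "(\<Sum>b\<in>Basis. integral unit_cube (\<lambda>x. ?w b x * dir_deriv b u x)) =
      integral unit_cube (\<lambda>x. \<Sum>b\<in>Basis. ?w b x * dir_deriv b u x)"
    by (rule integral_sum[symmetric])
       (auto intro!: continuous_cube_integral(1) continuous_on_mult wc dc)
  moreover have "(\<Sum>b\<in>Basis. integral unit_cube (\<lambda>x. m x * dir_deriv b (dir_deriv b u) x)) =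
      integral unit_cube (\<lambda>x. \<Sum>b\<in>Basis. m x * dir_deriv b (dir_deriv b u) x)"
    by (rule integral_sum[symmetric])
       (auto intro!: continuous_cube_integral(1) continuous_on_mult m ddc)
  ultimately show ?thesis
    by (simp add: inner_grad laplacian_def sum_distrib_left mult.assoc)
qed

section \<open>Extrema of functions of class \<open>C\<^sup>2\<close>\<close>

lemma second_derivative_at_minimum:
  fixes g g' :: "real \<Rightarrow> real"
  assumes g: "\<And>t. (g has_real_derivative g' t) (at t)"
    and g': "(g' has_real_derivative d) (at 0)"
    and min: "\<And>t. g 0 \<le> g t"
  shows "g' 0 = 0" "0 \<le> d"
proof -
  show g'0: "g' 0 = 0"
    using DERIV_local_min[OF g, of 1 0] min by simp
  show "0 \<le> d"
  proof (rule ccontr)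
    assume "\<not> 0 \<le> d"
    then obtain e where e: "0 < e" "\<And>h. 0 < h \<Longrightarrow> h < e \<Longrightarrow> g' h < g' 0"
      using DERIV_neg_dec_right[OF g'] by auto
    obtain z where z: "0 < z" "z < e / 2" "g (e / 2) - g 0 = (e / 2 - 0) * g' z"
      using MVT2[of 0 "e / 2" g g'] g e(1) by auto
    have "g' z < 0" using e(2)[of z] z e(1) g'0 by simp
    then have "(e / 2 - 0) * g' z < 0" using e(1) by (intro mult_pos_neg) simp_all
    with z(3) min[of "e / 2"] show False by simp
  qed
qed

lemma has_real_derivative_along_line:
  fixes f :: "'a::euclidean_space \<Rightarrow> real"
  assumes "\<And>x. f differentiable (at x)"
  shows "((\<lambda>t. f (x + t *\<^sub>R b)) has_real_derivative dir_deriv b f (x + t *\<^sub>R b)) (at t)"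
proof -
  have "((\<lambda>t. x + t *\<^sub>R b) has_derivative (\<lambda>h. h *\<^sub>R b)) (at t)"
    by (auto intro!: derivative_eq_intros)
  from has_derivative_compose[OF this has_derivative_grad[OF assms]]
  have "((\<lambda>t. f (x + t *\<^sub>R b)) has_derivative (\<lambda>h. grad f (x + t *\<^sub>R b) \<bullet> (h *\<^sub>R b))) (at t)" .
  moreover have "dir_deriv b f y = grad f y \<bullet> b" for y
    by (rule dir_deriv_eq[OF has_derivative_grad[OF assms]])
  ultimately show ?thesis
    by (simp add: has_field_derivative_def mult.commute[of _ "grad f _ \<bullet> b"])
qed

lemma minimum_principle:
  fixes f :: "'a::euclidean_space \<Rightarrow> real"
  assumes f: "Ck 2 f" and min: "\<And>y. f x \<le> f y"
  shows "grad f x = 0" "0 \<le> laplacian f x"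
proof -
  have *: "dir_deriv b f x = 0 \<and> 0 \<le> dir_deriv b (dir_deriv b f) x" if b: "b \<in> Basis" for b
  proof -
    have diff: "\<And>x. f differentiable (at x)" "\<And>x. dir_deriv b f differentiable (at x)"
      using f b by (simp_all add: Ck_2_iff Ck_1_iff)
    show ?thesis
      using second_derivative_at_minimum[OF has_real_derivative_along_line[OF diff(1), of x b]
          has_real_derivative_along_line[OF diff(2), of x b 0]] min by simp
  qed
  show "grad f x = 0" using * by (simp add: grad_def)
  show "0 \<le> laplacian f x" using * by (simp add: laplacian_def sum_nonneg)
qed

lemma maximum_principle:
  fixes f :: "'a::euclidean_space \<Rightarrow> real"
  assumes f: "Ck 2 f" and max: "\<And>y. f y \<le> f x"
  shows "grad f x = 0" "laplacian f x \<le> 0"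
proof -
  have *: "dir_deriv b f x = 0 \<and> dir_deriv b (dir_deriv b f) x \<le> 0" if b: "b \<in> Basis" for b
  proof -
    have diff: "\<And>x. f differentiable (at x)" "\<And>x. dir_deriv b f differentiable (at x)"
      using f b by (simp_all add: Ck_2_iff Ck_1_iff)
    show ?thesis
      using second_derivative_at_minimum[OF DERIV_minus[OF has_real_derivative_along_line[OF diff(1), of x b]]
          DERIV_minus[OF has_real_derivative_along_line[OF diff(2), of x b 0]]] max by simp
  qed
  show "grad f x = 0" using * by (simp add: grad_def)
  show "laplacian f x \<le> 0" using * by (simp add: laplacian_def sum_nonpos)
qed

text \<open>
  The extrema over the compact cube are global, as the cube represents all values.
\<close>

lemma periodic_attains_bounds:
  fixes f :: "real^'n \<Rightarrow> real"
  assumes per: "periodic f" and cont: "continuous_on UNIV f"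
  obtains x y where "\<And>z. f x \<le> f z" "\<And>z. f z \<le> f y"
proof -
  have ne: "(unit_cube :: (real^'n) set) \<noteq> {}" by (simp add: interval_ne_empty_cart)
  have c: "continuous_on unit_cube f" by (rule continuous_on_subset[OF cont]) simp
  obtain x where x: "\<forall>z\<in>unit_cube. f x \<le> f z"
    using continuous_attains_inf[OF compact_cbox ne c] by blast
  obtain y where y: "\<forall>z\<in>unit_cube. f z \<le> f y"
    using continuous_attains_sup[OF compact_cbox ne c] by blast
  have rep: "\<exists>z'\<in>unit_cube. f z = f z'" for z
  proof -
    have "f z \<in> f ` unit_cube" unfolding periodic_image[OF per, symmetric] by (rule rangeI)
    then show ?thesis by (simp add: image_iff)
  qed
  show thesis
  proof (rule that)
    show "f x \<le> f z" for z using rep[of z] x by auto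
    show "f z \<le> f y" for z using rep[of z] y by auto
  qed
qed

section \<open>Estimates for the cell problem\<close>

text \<open>
  The bounds on \<open>h\<close> come from the equation at a minimum and at a maximum of \<open>u\<close>, where the gradient
  vanishes and the Laplacian has a sign. The bound on the drift is an energy estimate. Since
  \<open>V \<ge> 0\<close>, integrating the Hamilton-Jacobi equation against \<open>m\<close>, and using the Fokker-Planck
  equation with test function \<open>u\<close>, bounds the integral of \<open>m |\<nabla>u|\<^sup>2\<close> by \<open>|P|\<^sup>2 - 2 h \<le> 2 C\<close>. As \<open>m\<close> is a
  probability density, this controls the integral of \<open>m \<nabla>u\<close>, the difference between the drift
  and \<open>P\<close>. The constants do not depend on \<open>\<alpha>\<close>.
\<close>

lemma cell_solution_estimates:
  fixes V :: "real^'n \<Rightarrow> real \<Rightarrow> real"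
  assumes sol: "cell_solution V P \<alpha> h u m"
    and V: "\<And>y s. 0 \<le> V y s" "\<And>y s. V y s \<le> C"
  shows "h \<le> (norm P)\<^sup>2 / 2" "(norm P)\<^sup>2 / 2 - C \<le> h"
    "norm ((LINT y:unit_cube|lebesgue. m y *\<^sub>R (grad u y + P)) - P) \<le> 1/2 + C"
proof -
  have "C2_holder (1/2) u" using sol by (simp add: cell_solution_def)
  then have per: "periodic u" and u: "Ck 2 u" by (simp_all add: C2_holder_def)
  have mc: "continuous_on UNIV m" and mpos: "\<And>y. 0 < m y" and fp: "weak_fokker_planck P u m"
    and pde: "\<And>y. - laplacian u y + (1/2) * (norm (grad u y + P))\<^sup>2 - V y (\<alpha> * m y) = h"
    and "(LINT y:unit_cube|lebesgue. m y) = 1"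
    using sol by (simp_all add: cell_solution_def)
  then have m1: "integral unit_cube m = 1" using continuous_cube_integral(3)[OF mc] by simp
  have u1: "Ck 1 u" by (rule Ck_2_imp_1[OF u])
  have gc: "continuous_on UNIV (grad u)" by (rule Ck_1_grad_continuous[OF u1])
  have lc: "continuous_on UNIV (laplacian u)"
    unfolding laplacian_def[abs_def] using u
    by (intro continuous_on_sum) (simp add: Ck_2_iff Ck_1_iff)
  obtain x y where x: "\<And>z. u x \<le> u z" and y: "\<And>z. u z \<le> u y"
    using periodic_attains_bounds[OF per Ck_1_continuous[OF u1]] by blast
  show "h \<le> (norm P)\<^sup>2 / 2"
    using pde[of x] minimum_principle[OF u x] V(1)[of x "\<alpha> * m x"] by simp
  show lower: "(norm P)\<^sup>2 / 2 - C \<le> h"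
    using pde[of y] maximum_principle[OF u y] V(2)[of y "\<alpha> * m y"] by simp
  let ?g2 = "\<lambda>y. m y * (norm (grad u y))\<^sup>2"
  have g2c: "continuous_on UNIV ?g2" by (intro continuous_on_mult mc continuous_on_power continuous_on_norm gc)
  have energy: "integral unit_cube ?g2 \<le> 2 * C"
  proof -
    let ?a = "\<lambda>y. m y * ((grad u y + P) \<bullet> grad u y)" and ?b = "\<lambda>y. m y * laplacian u y"
    have ac: "continuous_on UNIV ?a"
      by (intro continuous_on_mult mc continuous_on_inner continuous_on_add gc continuous_on_const)
    have bc: "continuous_on UNIV ?b" by (intro continuous_on_mult mc lc)
    note int = continuous_cube_integral(1)
    \<comment> \<open>Completing the square replaces \<open>\<bar>\<nabla>u + P\<bar>\<^sup>2\<close> by the term \<open>(\<nabla>u + P) \<bullet> \<nabla>u\<close> that the dual equation controls.\<close>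
    have ptw: "?g2 y \<le> 2 * (?a y - ?b y) + ((norm P)\<^sup>2 - 2 * h) * m y" for y
    proof -
      have arith: "q \<le> 2 * (i - l) + (p - 2 * h)" if "h \<le> - l + (1/2) * n" "n = 2 * i - q + p"
        for q i l p n :: real using that by (simp add: algebra_simps)
      have "(norm (grad u y + P))\<^sup>2 =
          2 * ((grad u y + P) \<bullet> grad u y) - (norm (grad u y))\<^sup>2 + (norm P)\<^sup>2"
        by (simp add: power2_norm_eq_inner inner_add_left inner_add_right inner_commute)
      moreover have "h \<le> - laplacian u y + (1/2) * (norm (grad u y + P))\<^sup>2"
        using pde[of y] V(1)[of y "\<alpha> * m y"] by linarith
      ultimately have "(norm (grad u y))\<^sup>2 \<le>
          2 * ((grad u y + P) \<bullet> grad u y - laplacian u y) + ((norm P)\<^sup>2 - 2 * h)"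
        by (intro arith)
      from mult_left_mono[OF this less_imp_le[OF mpos[of y]]] show ?thesis
        by (simp add: algebra_simps)
    qed
    have "integral unit_cube ?g2 \<le> integral unit_cube (\<lambda>y. 2 * (?a y - ?b y) + ((norm P)\<^sup>2 - 2 * h) * m y)"
      by (intro integral_le int g2c ptw continuous_on_add continuous_on_mult continuous_on_diff
            continuous_on_const ac bc mc)
    also have "\<dots> = integral unit_cube (\<lambda>y. 2 * (?a y - ?b y)) + integral unit_cube (\<lambda>y. ((norm P)\<^sup>2 - 2 * h) * m y)"
      by (intro integral_add int continuous_on_mult continuous_on_diff continuous_on_const ac bc mc)
    also have "integral unit_cube (\<lambda>y. 2 * (?a y - ?b y)) = 2 * (integral unit_cube ?a - integral unit_cube ?b)"
      by (simp only: integral_mult_right Henstock_Kurzweil_Integration.integral_diff[OF int[OF ac] int[OF bc]])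
    also have "integral unit_cube (\<lambda>y. ((norm P)\<^sup>2 - 2 * h) * m y) = (norm P)\<^sup>2 - 2 * h"
      by (simp add: m1)
    finally show ?thesis using dual_equation[OF fp mc per u] lower by simp
  qed
  have "(LINT y:unit_cube|lebesgue. m y *\<^sub>R (grad u y + P)) = integral unit_cube (\<lambda>y. m y *\<^sub>R (grad u y + P))"
    by (intro continuous_cube_integral continuous_on_scaleR mc continuous_on_add gc continuous_on_const)
  also have "\<dots> = integral unit_cube (\<lambda>y. m y *\<^sub>R grad u y) + integral unit_cube (\<lambda>y. m y *\<^sub>R P)"
    unfolding scaleR_add_right
    by (intro integral_add continuous_cube_integral continuous_on_scaleR mc gc continuous_on_const)
  also have "integral unit_cube (\<lambda>y. m y *\<^sub>R P) = P"
  proof -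
    have "(m has_integral 1) unit_cube"
      using continuous_cube_integral(1)[OF mc] m1 by (simp add: has_integral_iff)
    from has_integral_scaleR_left[OF this, of P] show ?thesis by (simp add: integral_unique)
  qed
  finally have "(LINT y:unit_cube|lebesgue. m y *\<^sub>R (grad u y + P)) - P = integral unit_cube (\<lambda>y. m y *\<^sub>R grad u y)"
    by simp
  also have "norm \<dots> \<le> integral unit_cube (\<lambda>y. (1/2) * m y + (1/2) * ?g2 y)"
  proof (rule integral_norm_bound_integral)
    show "(\<lambda>y. m y *\<^sub>R grad u y) integrable_on unit_cube"
      by (intro continuous_cube_integral continuous_on_scaleR mc gc)
    show "(\<lambda>y. (1/2) * m y + (1/2) * ?g2 y) integrable_on unit_cube"
      by (intro continuous_cube_integral continuous_on_add continuous_on_mult[OF continuous_on_const] mc g2c)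
    fix y :: "real^'n"
    \<comment> \<open>The weight \<open>m\<close> has total mass \<open>1\<close>, so the constant term contributes the summand \<open>1/2\<close> of the bound.\<close>
    have "norm (grad u y) \<le> 1/2 + 1/2 * (norm (grad u y))\<^sup>2"
      using sum_squares_bound[of 1 "norm (grad u y)"] by simp
    from mult_left_mono[OF this less_imp_le[OF mpos[of y]]]
    show "norm (m y *\<^sub>R grad u y) \<le> (1/2) * m y + (1/2) * ?g2 y"
      using mpos[of y] by (simp add: algebra_simps)
  qed
  also have "\<dots> = 1/2 + 1/2 * integral unit_cube ?g2"
    using integral_add[OF continuous_cube_integral(1)[OF continuous_on_mult[OF continuous_on_const mc]]
        continuous_cube_integral(1)[OF continuous_on_mult[OF continuous_on_const g2c]], of "1/2" "1/2"] m1
    by simp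
  finally show "norm ((LINT y:unit_cube|lebesgue. m y *\<^sub>R (grad u y + P)) - P) \<le> 1/2 + C"
    using energy by simp
qed

lemma uniform_limit_at_infinityI:
  fixes f :: "'a::real_normed_vector \<Rightarrow> 'b \<Rightarrow> real"
  assumes "\<And>P a. a \<in> S \<Longrightarrow> 1 \<le> norm P \<Longrightarrow> \<bar>f P a - l a\<bar> \<le> K / norm P"
  shows "uniform_limit S f l at_infinity"
proof (rule uniform_limitI)
  fix e :: real assume e: "0 < e"
  show "\<forall>\<^sub>F P in at_infinity. \<forall>a\<in>S. dist (f P a) (l a) < e"
    unfolding eventually_at_infinity
  proof (intro exI[of _ "max 1 ((\<bar>K\<bar> + 1) / e)"] allI impI ballI)
    fix P :: 'a and a :: 'b assume P: "max 1 ((\<bar>K\<bar> + 1) / e) \<le> norm P" and a: "a \<in> S"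
    then have "1 \<le> norm P" "\<bar>K\<bar> + 1 \<le> e * norm P"
      using e by (auto simp: divide_le_eq mult.commute)
    then have "K / norm P < e" by (auto simp: divide_less_eq)
    with assms[OF a \<open>1 \<le> norm P\<close>] show "dist (f P a) (l a) < e" by (simp add: dist_real_def)
  qed
qed

theorem proposition6p1:
  fixes V :: "real^'n \<Rightarrow> real \<Rightarrow> real"
    and Hb :: "real^'n \<Rightarrow> real \<Rightarrow> real"
    and bb :: "real^'n \<Rightarrow> real \<Rightarrow> real^'n"
  assumes "admissible_potential V"
    and "effective_operators V Hb bb"
  shows "uniform_limit {0..} (\<lambda>P \<alpha>. Hb P \<alpha> / (norm P)\<^sup>2) (\<lambda>\<alpha>. 1/2) at_infinity \<and>
         uniform_limit {0..} (\<lambda>P \<alpha>. norm (bb P \<alpha> - P) / norm P) (\<lambda>\<alpha>. 0) at_infinity"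
proof -
  have "\<exists>C. \<forall>y m. \<bar>V y m\<bar> \<le> C" and V0: "0 \<le> V y m" for y m
    using assms(1) by (simp_all only: admissible_potential_def)
  then obtain C where C: "\<bar>V y m\<bar> \<le> C" for y m by blast
  have VC: "V y m \<le> C" for y m using C[of y m] by simp
  have est: "Hb P \<alpha> \<le> (norm P)\<^sup>2 / 2 \<and> (norm P)\<^sup>2 / 2 - C \<le> Hb P \<alpha> \<and> norm (bb P \<alpha> - P) \<le> 1/2 + C"
    if "\<alpha> \<in> {0..}" for P \<alpha>
  proof -
    have "0 \<le> \<alpha>" using that by simp
    with assms(2) obtain u m where um: "cell_solution V P \<alpha> (Hb P \<alpha>) u m"
      "bb P \<alpha> = (LINT y:unit_cube|lebesgue. m y *\<^sub>R (grad u y + P))"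
      unfolding effective_operators_def by blast
    show ?thesis
      unfolding um(2) using cell_solution_estimates[OF um(1) V0 VC] by (intro conjI)
  qed
  show ?thesis
  proof
    show "uniform_limit {0..} (\<lambda>P \<alpha>. Hb P \<alpha> / (norm P)\<^sup>2) (\<lambda>\<alpha>. 1/2) at_infinity"
    proof (rule uniform_limit_at_infinityI)
      fix P :: "real^'n" and \<alpha> :: real
      assume \<alpha>: "\<alpha> \<in> {0..}" and P: "1 \<le> norm P"
      then have pos: "0 < norm P" by linarith
      have C0: "0 \<le> C" using C[of 0 0] by simp
      have "Hb P \<alpha> / (norm P)\<^sup>2 - 1/2 = (Hb P \<alpha> - (norm P)\<^sup>2 / 2) / (norm P)\<^sup>2"
        using pos by (simp add: diff_divide_distrib)
      then have "\<bar>Hb P \<alpha> / (norm P)\<^sup>2 - 1/2\<bar> = \<bar>Hb P \<alpha> - (norm P)\<^sup>2 / 2\<bar> / (norm P)\<^sup>2"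
        by (simp add: abs_divide)
      also have "\<dots> \<le> C / (norm P)\<^sup>2"
        using est[OF \<alpha>, of P] by (intro divide_right_mono) auto
      also have "\<dots> \<le> C / norm P"
        using C0 P pos by (intro divide_left_mono) (auto simp: power2_eq_square)
      finally show "\<bar>Hb P \<alpha> / (norm P)\<^sup>2 - 1/2\<bar> \<le> C / norm P" .
    qed
    show "uniform_limit {0..} (\<lambda>P \<alpha>. norm (bb P \<alpha> - P) / norm P) (\<lambda>\<alpha>. 0) at_infinity"
    proof (rule uniform_limit_at_infinityI)
      fix P :: "real^'n" and \<alpha> :: real
      assume \<alpha>: "\<alpha> \<in> {0..}" and "1 \<le> norm P"
      then show "\<bar>norm (bb P \<alpha> - P) / norm P - 0\<bar> \<le> (1/2 + C) / norm P"
        using est[OF \<alpha>, of P] by (simp add: divide_right_mono)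
    qed
  qed
qed

end
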